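(* Let $\mathscr{A}=(\mathscr{A},f,g)$ be a commutative Krasner $(m,n)$-hyperring with scalar identity $1_{\mathscr{A}}$, let $S$ be an $n$-ary multiplicative subset of $\mathscr{A}$, and let $\{P_j\}_{j\in\Delta}$ be a non-empty family of $n$-ary $S$-hyperideals of $\mathscr{A}$. Then $\bigcap_{j\in\Delta}P_j$ is an $n$-ary $S$-hyperideal of $\mathscr{A}$.
   Context: Let $m,n\ge 2$. Notation: $p_i^j$ denotes the sequence $p_i,\dots,p_j$ (empty if $j<i$); $p^{(k)}$ denotes $p$ repeated $k$ times; for non-empty subsets, $f(P_1^m)=\bigcup\{f(p_1^m)\mid p_i\in P_i\}$ and similarly for $g$; singletons are identified with elements. A canonical $m$-ary hypergroup $(\mathscr{A},f)$ is a set with $f:\mathscr{A}^m\to\{\text{non-empty subsets of }\mathscr{A}\}$ such that: $f$ is associative ($f(p_1^{i-1},f(p_i^{m+i-1}),p_{m+i}^{2m-1})$ is independent of $i$) and invariant under permutations of its arguments; there is a unique $0$ with $f(p,0^{(m-1)})=\{p\}$ for all $p$; each $p$ has a unique $-p$ with $0\in f(p,-p,0^{(m-2)})$; and $p\in f(p_1^m)$ implies $p_i\in f(p,-p_1,\dots,-p_{i-1},-p_{i+1},\dots,-p_m)$ for each $i$. A commutative Krasner $(m,n)$-hyperring with scalar identity $1_{\mathscr{A}}$ is $(\mathscr{A},f,g)$ with $(\mathscr{A},f)$ a canonical $m$-ary hypergroup, $g:\mathscr{A}^n\to\mathscr{A}$ an associative operation invariant under permutations of its arguments, $g$ distributive over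 $f$ in each argument ($g(p_1^{i-1},f(q_1^m),p_{i+1}^n)=f(g(p_1^{i-1},q_1,p_{i+1}^n),\dots,g(p_1^{i-1},q_m,p_{i+1}^n))$), $g(0,p_2^n)=0$, and $g(p,1_{\mathscr{A}}^{(n-1)})=p$ for all $p$. A hyperideal is a non-empty $P\subseteq\mathscr{A}$ with $f(p_1^m)\subseteq P$ and $-p\in P$ for all $p,p_1,\dots,p_m\in P$, and $g(p_1^{i-1},P,p_{i+1}^n)\subseteq P$ for all $p_j\in\mathscr{A}$ and all $i$; it is proper if $P\ne\mathscr{A}$. An $n$-ary multiplicative subset is a non-empty $S\subseteq\mathscr{A}$ with $g(s_1^n)\in S$ for all $s_1,\dots,s_n\in S$. Given such $S$, an $n$-ary $S$-hyperideal is a proper hyperideal $P$ such that whenever $g(p_1^n)\in P$ with $p_1,\dots,p_n\in\mathscr{A}$ and $p_i\in S$ for some $i$, then $g(p_1^{i-1},1_{\mathscr{A}},p_{i+1}^n)\in P$. *)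

theory Defs
  imports "HOL-Library.Multiset" "HOL-Library.NList"
begin

text \<open>
  A tuple in \<open>A\<^sup>k\<close> is a list in \<open>nlists k A\<close>; list positions count from 0.  Operations are functions
  on lists, and their values on lists that are not tuples of the right length over \<open>A\<close> play no role.
  An argument list \<open>p\<^sub>1, \<dots>, p\<^sub>i\<^sub>-\<^sub>1, x, p\<^sub>i\<^sub>+\<^sub>1, \<dots>, p\<^sub>n\<close> is written \<open>ps[i := x]\<close>; it does not depend
  on the entry of \<open>ps\<close> at position \<open>i\<close>.  A set in an argument position is expanded into the union
  (or image) over its elements.
\<close>

definition is_zero :: "'a set \<Rightarrow> nat \<Rightarrow> ('a list \<Rightarrow> 'a set) \<Rightarrow> 'a \<Rightarrow> bool" where
  "is_zero A m f z \<longleftrightarrow> z \<in> A \<and> (\<forall>p\<in>A. f (p # replicate (m - 1) z) = {p})"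

definition zero_elem :: "'a set \<Rightarrow> nat \<Rightarrow> ('a list \<Rightarrow> 'a set) \<Rightarrow> 'a" where
  "zero_elem A m f = (THE z. is_zero A m f z)"

definition is_neg :: "'a set \<Rightarrow> nat \<Rightarrow> ('a list \<Rightarrow> 'a set) \<Rightarrow> 'a \<Rightarrow> 'a \<Rightarrow> bool" where
  "is_neg A m f p q \<longleftrightarrow>
     q \<in> A \<and> zero_elem A m f \<in> f (p # q # replicate (m - 2) (zero_elem A m f))"

definition neg_elem :: "'a set \<Rightarrow> nat \<Rightarrow> ('a list \<Rightarrow> 'a set) \<Rightarrow> 'a \<Rightarrow> 'a" where
  "neg_elem A m f p = (THE q. is_neg A m f p q)"

locale canonical_hypergroup =
  fixes A :: "'a set" and m :: nat and f :: "'a list \<Rightarrow> 'a set"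
  assumes arity_f: "m \<ge> 2"
    and f_closed: "ps \<in> nlists m A \<Longrightarrow> f ps \<subseteq> A"
    and f_nonempty: "ps \<in> nlists m A \<Longrightarrow> f ps \<noteq> {}"
    and f_assoc: "\<lbrakk>ps \<in> nlists (2 * m - 1) A; i < m; j < m\<rbrakk> \<Longrightarrow>
        (\<Union>x \<in> f (take m (drop i ps)). f (take i ps @ x # drop (i + m) ps)) =
        (\<Union>x \<in> f (take m (drop j ps)). f (take j ps @ x # drop (j + m) ps))"
    and f_perm: "\<lbrakk>ps \<in> nlists m A; mset qs = mset ps\<rbrakk> \<Longrightarrow> f qs = f ps"
    and zero_ex1: "\<exists>!z. is_zero A m f z"
    and neg_ex1: "p \<in> A \<Longrightarrow> \<exists>!q. is_neg A m f p q"
    and reversible: "\<lbrakk>ps \<in> nlists m A; p \<in> f ps; i < m\<rbrakk> \<Longrightarrow>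
        ps ! i \<in> f (p # map (neg_elem A m f) (take i ps @ drop (Suc i) ps))"

locale comm_krasner_hyperring = canonical_hypergroup A m f
  for A :: "'a set" and m n :: nat
    and f :: "'a list \<Rightarrow> 'a set" and g :: "'a list \<Rightarrow> 'a" and one :: 'a +
  assumes arity_g: "n \<ge> 2"
    and g_closed: "ps \<in> nlists n A \<Longrightarrow> g ps \<in> A"
    and g_assoc: "\<lbrakk>ps \<in> nlists (2 * n - 1) A; i < n; j < n\<rbrakk> \<Longrightarrow>
        g (take i ps @ g (take n (drop i ps)) # drop (i + n) ps) =
        g (take j ps @ g (take n (drop j ps)) # drop (j + n) ps)"
    and g_perm: "\<lbrakk>ps \<in> nlists n A; mset qs = mset ps\<rbrakk> \<Longrightarrow> g qs = g ps"
    and distrib: "\<lbrakk>ps \<in> nlists n A; qs \<in> nlists m A; i < n\<rbrakk> \<Longrightarrow>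
        (\<lambda>x. g (ps[i := x])) ` f qs = f (map (\<lambda>q. g (ps[i := q])) qs)"
    and g_zero: "ps \<in> nlists (n - 1) A \<Longrightarrow> g (zero_elem A m f # ps) = zero_elem A m f"
    and one_closed: "one \<in> A"
    and g_one: "p \<in> A \<Longrightarrow> g (p # replicate (n - 1) one) = p"

definition hyperideal ::
    "'a set \<Rightarrow> nat \<Rightarrow> nat \<Rightarrow> ('a list \<Rightarrow> 'a set) \<Rightarrow> ('a list \<Rightarrow> 'a) \<Rightarrow> 'a set \<Rightarrow> bool" where
  "hyperideal A m n f g P \<longleftrightarrow>
     P \<noteq> {} \<and> P \<subseteq> A \<and>
     (\<forall>ps \<in> nlists m P. f ps \<subseteq> P) \<and>
     (\<forall>p \<in> P. neg_elem A m f p \<in> P) \<and>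
     (\<forall>ps \<in> nlists n A. \<forall>i < n. \<forall>x \<in> P. g (ps[i := x]) \<in> P)"

definition proper_hyperideal ::
    "'a set \<Rightarrow> nat \<Rightarrow> nat \<Rightarrow> ('a list \<Rightarrow> 'a set) \<Rightarrow> ('a list \<Rightarrow> 'a) \<Rightarrow> 'a set \<Rightarrow> bool" where
  "proper_hyperideal A m n f g P \<longleftrightarrow> hyperideal A m n f g P \<and> P \<noteq> A"

definition mult_subset :: "'a set \<Rightarrow> nat \<Rightarrow> ('a list \<Rightarrow> 'a) \<Rightarrow> 'a set \<Rightarrow> bool" where
  "mult_subset A n g S \<longleftrightarrow> S \<noteq> {} \<and> S \<subseteq> A \<and> (\<forall>ss \<in> nlists n S. g ss \<in> S)"

definition S_hyperideal ::
    "'a set \<Rightarrow> nat \<Rightarrow> nat \<Rightarrow> ('a list \<Rightarrow> 'a set) \<Rightarrow> ('a list \<Rightarrow> 'a) \<Rightarrow> 'a \<Rightarrow> 'a set \<Rightarrow> 'a set \<Rightarrow> bool" where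
  "S_hyperideal A m n f g one S P \<longleftrightarrow>
     proper_hyperideal A m n f g P \<and>
     (\<forall>ps \<in> nlists n A. \<forall>i < n. g ps \<in> P \<and> ps ! i \<in> S \<longrightarrow> g (ps[i := one]) \<in> P)"

end

theory Submission
  imports Defs
begin

text \<open>Closure under \<open>f\<close>, negation, absorption and the \<open>S\<close>-condition
  all pass to intersections, since each can be checked in every \<open>P j\<close> separately. Two
  points remain. The intersection is non-empty because every hyperideal contains zero
  (\<open>zero_in_hyperideal\<close>, used in \<open>hyperideal_INT\<close>), and it is proper
  because it lies inside some proper \<open>P j\<close>.\<close>

lemma (in canonical_hypergroup) zero_elem_closed: "zero_elem A m f \<in> A"
  using theI'[OF zero_ex1] unfolding zero_elem_def is_zero_def by blast

lemma hyperideal_subset: "hyperideal A m n f g P \<Longrightarrow> P \<subseteq> A"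
  by (simp add: hyperideal_def)

text \<open>A product of zeros and one \<open>x\<close> in \<open>P\<close> lies in \<open>P\<close>
  by absorption and equals zero. Using zero in \<open>f\<close> of \<open>x\<close>, its negative
  and zeros instead would be circular for \<open>m > 2\<close>, as those zeros must already lie in
  \<open>P\<close>.\<close>

lemma (in comm_krasner_hyperring) zero_in_hyperideal:
  assumes "hyperideal A m n f g P"
  shows "zero_elem A m f \<in> P"
proof -
  let ?z = "zero_elem A m f"
  obtain x where x: "x \<in> P" "x \<in> A"
    using assms hyperideal_subset[OF assms] by (auto simp: hyperideal_def)
  have zeros: "replicate k ?z \<in> nlists k A" for k
    by (intro nlistsI length_replicate subsetI) (metis in_set_replicate zero_elem_closed)
  have "1 < n"
    using arity_g by linarith
  \<comment> \<open>\<open>x\<close> goes to position 1, which exists as \<open>n \<ge> 2\<close>,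
    so that the head stays zero as \<open>g_zero\<close> requires.\<close>
  then have "g ((replicate n ?z)[1 := x]) \<in> P"
    using assms x(1) zeros unfolding hyperideal_def by blast
  moreover have "(replicate n ?z)[1 := x] = ?z # (replicate (n - 1) ?z)[0 := x]"
    using \<open>1 < n\<close> by (cases n) simp_all
  moreover have "g (?z # (replicate (n - 1) ?z)[0 := x]) = ?z"
    by (intro g_zero nlists_update_in_list zeros x(2))
  ultimately show ?thesis
    by (simp only:)
qed

lemma (in comm_krasner_hyperring) hyperideal_INT:
  assumes "\<Delta> \<noteq> {}" and ideal: "\<And>j. j \<in> \<Delta> \<Longrightarrow> hyperideal A m n f g (P j)"
  shows "hyperideal A m n f g (\<Inter>j\<in>\<Delta>. P j)"
  unfolding hyperideal_def
proof (intro conjI ballI allI impI)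
  show "(\<Inter>j\<in>\<Delta>. P j) \<noteq> {}"
    using zero_in_hyperideal[OF ideal] by blast
  \<comment> \<open>The intersection of an empty family would be the whole type, hence the need for
    some index.\<close>
  show "(\<Inter>j\<in>\<Delta>. P j) \<subseteq> A"
    using assms(1) hyperideal_subset[OF ideal] by blast
next
  fix ps assume "ps \<in> nlists m (\<Inter>j\<in>\<Delta>. P j)"
  then have "ps \<in> nlists m (P j)" if "j \<in> \<Delta>" for j
    using nlists_mono[OF INF_lower[OF that]] by blast
  then show "f ps \<subseteq> (\<Inter>j\<in>\<Delta>. P j)"
    using ideal by (simp add: hyperideal_def INT_greatest)
qed (use ideal in \<open>simp_all add: hyperideal_def\<close>)

theorem proposition3p13:
  fixes A :: "'a set" and m n :: nat
    and f :: "'a list \<Rightarrow> 'a set" and g :: "'a list \<Rightarrow> 'a" and one :: 'a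
    and S :: "'a set" and \<Delta> :: "'j set" and P :: "'j \<Rightarrow> 'a set"
  assumes "comm_krasner_hyperring A m n f g one"
    and "mult_subset A n g S"
    and "\<Delta> \<noteq> {}"
    and "\<And>j. j \<in> \<Delta> \<Longrightarrow> S_hyperideal A m n f g one S (P j)"
  shows "S_hyperideal A m n f g one S (\<Inter>j\<in>\<Delta>. P j)"
proof -
  have proper: "hyperideal A m n f g (P j)" "P j \<noteq> A" if "j \<in> \<Delta>" for j
    using assms(4)[OF that] by (auto simp: S_hyperideal_def proper_hyperideal_def)
  have "hyperideal A m n f g (\<Inter>j\<in>\<Delta>. P j)"
    using comm_krasner_hyperring.hyperideal_INT[OF assms(1,3) proper(1)] .
  \<comment> \<open>Equality would force \<open>A \<subseteq> P j \<subseteq> A\<close> for any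
    index \<open>j\<close>.\<close>
  moreover have "(\<Inter>j\<in>\<Delta>. P j) \<noteq> A"
    using assms(3) proper(2) hyperideal_subset[OF proper(1)] by blast
  ultimately show ?thesis
    using assms(4) by (simp add: S_hyperideal_def proper_hyperideal_def)
qed

end
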